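(* Let $n\ge 0$ and $t\ge 0$ be integers, let $P$ be a graded poset of rank $n+1$, and let $R=\operatorname{Rees}(P,T_{t,n+1})$. Then for every $S\subseteq\{1,\dots,n\}$ the flag $f$-vector of $R$ satisfies $$f_S(R)=\operatorname{w}(S)\cdot f_S(P),\qquad f_{S\cup\{n+1\}}(R)=\operatorname{w}(S\cup\{n+1\})\cdot f_S(P).$$
   Context: All posets are finite. A graded poset $P$ has a unique minimal element $\hat 0$ and a unique maximal element $\hat 1$, all of its maximal chains have the same length, and its rank function $\rho$ satisfies $\rho(\hat 0)=0$; the rank of $P$ is $\rho(\hat 1)$. For a graded poset $P$ of rank $m+1$ and $S=\{s_1<\cdots<s_k\}\subseteq\{1,\dots,m\}$, $f_S(P)$ is the number of chains $\hat 0<x_1<\cdots<x_k<\hat 1$ in $P$ with $\rho(x_i)=s_i$ for all $i$ (so $f_\emptyset(P)=1$). Rees product: for posets $P,Q$ with rank functions $\rho$ (minimal elements having rank $0$), $P*Q$ is the set of pairs $(p,q)\in P\times Q$ with $\rho(p)\ge\rho(q)$, ordered by $(p,q)\le(p',q')$ iff $p\le_P p'$, $q\le_Q q'$ and $\rho(p')-\rho(p)\ge\rho(q')-\rho(q)$. For $P$ graded, $\operatorname{Rees}(P,Q)=((P-\{\hat 0\})*Q)\cup\{\hat 0,\hat 1\}$, where a new minimum $\hat 0$ and a new maximum $\hat 1$ are adjoined, and where in $P-\{\hat 0\}$ the atoms of $P$ have rank $0$. (If $P$ has rank $n+1$, $\operatorname{Rees}(P,T_{t,n+1})$ is graded of rank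 $n+2$.) $T_{t,n+1}$ is the poset of a $t$-ary tree of rank $n$: it has $t^k$ elements of rank $k$ for $0\le k\le n$, and each nonleaf element is covered by exactly $t$ children (the root is the minimum). $[k]=1+t+\cdots+t^{k-1}$, with $[0]=0$. For a nonempty finite set $S=\{s_1<\cdots<s_k\}$ of positive integers, $\operatorname{w}(S)=[s_1]\cdot[s_2-s_1+1]\cdots[s_k-s_{k-1}+1]$, and $\operatorname{w}(\emptyset)=1$. *)

theory Defs
  imports Main "HOL-Library.Sublist"
begin

text \<open>
  A poset is represented by its reflexive order relation \<open>r\<close>; its carrier is \<^term>\<open>Field r\<close> and
  \<^term>\<open>(x, y) \<in> r\<close> means that \<open>x \<le> y\<close>. The length of a chain \<open>C\<close> is \<^term>\<open>card C - 1\<close>.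
\<close>

definition minimal_in :: "'a rel \<Rightarrow> 'a \<Rightarrow> bool" where
  "minimal_in r x \<longleftrightarrow> x \<in> Field r \<and> (\<forall>y. (y, x) \<in> r \<longrightarrow> y = x)"

definition maximal_in :: "'a rel \<Rightarrow> 'a \<Rightarrow> bool" where
  "maximal_in r x \<longleftrightarrow> x \<in> Field r \<and> (\<forall>y. (x, y) \<in> r \<longrightarrow> y = x)"

definition zero_hat :: "'a rel \<Rightarrow> 'a" where
  "zero_hat r = (THE x. minimal_in r x)"

definition one_hat :: "'a rel \<Rightarrow> 'a" where
  "one_hat r = (THE x. maximal_in r x)"

definition maximal_chains :: "'a rel \<Rightarrow> 'a set set" where
  "maximal_chains r = {C \<in> Chains r. \<forall>D \<in> Chains r. C \<subseteq> D \<longrightarrow> D = C}"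

definition graded :: "'a rel \<Rightarrow> bool" where
  "graded r \<longleftrightarrow> finite (Field r) \<and> Partial_order r
     \<and> (\<exists>!x. minimal_in r x) \<and> (\<exists>!x. maximal_in r x)
     \<and> (\<forall>C \<in> maximal_chains r. \<forall>D \<in> maximal_chains r. card C = card D)"

text \<open>
  The rank of \<open>x\<close> is the length of a longest chain with greatest element \<open>x\<close>. This gives minimal
  elements rank 0 and, on a graded poset, it is the usual rank function (see \<open>rank_of_covers\<close>). It
  also makes sense without a least element: in \<open>P - {zero_hat P}\<close> the atoms of \<open>P\<close> have rank 0,
  as the definition of \<open>Rees\<close> requires.
\<close>

definition rank_of :: "'a rel \<Rightarrow> 'a \<Rightarrow> nat" where
  "rank_of r x = Max {card C - 1 | C. C \<in> Chains r \<and> x \<in> C \<and> (\<forall>y\<in>C. (y, x) \<in> r)}"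

definition poset_rank :: "'a rel \<Rightarrow> nat" where
  "poset_rank r = rank_of r (one_hat r)"

definition strictly_below :: "'a rel \<Rightarrow> 'a \<Rightarrow> 'a \<Rightarrow> bool" where
  "strictly_below r x y \<longleftrightarrow> (x, y) \<in> r \<and> x \<noteq> y"

text \<open>
  The list \<open>xs\<close> is \<open>x\<^sub>1, \<dots>, x\<^sub>k\<close> in the chain \<open>0 < x\<^sub>1 < \<dots> < x\<^sub>k < 1\<close>.
\<close>

definition flag_f :: "'a rel \<Rightarrow> nat set \<Rightarrow> nat" where
  "flag_f r S = card {xs. sorted_wrt (strictly_below r) (zero_hat r # xs @ [one_hat r])
                        \<and> map (rank_of r) xs = sorted_list_of_set S}"

text \<open>The differences of ranks are taken in \<^typ>\<open>int\<close> to avoid truncated subtraction.\<close>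

definition rees_product :: "'a rel \<Rightarrow> 'b rel \<Rightarrow> ('a \<times> 'b) rel" where
  "rees_product P Q =
     {((p, q), (p', q')).
        rank_of P p \<ge> rank_of Q q \<and> rank_of P p' \<ge> rank_of Q q'
        \<and> (p, p') \<in> P \<and> (q, q') \<in> Q
        \<and> int (rank_of P p') - int (rank_of P p) \<ge> int (rank_of Q q') - int (rank_of Q q)}"

datatype 'a adjoined = New_Zero | Old 'a | New_One

definition adjoin_bounds :: "'a rel \<Rightarrow> 'a adjoined rel" where
  "adjoin_bounds r =
     (let A = {New_Zero, New_One} \<union> Old ` Field r
      in {(x, y) \<in> A \<times> A. x = New_Zero \<or> y = New_One
            \<or> (\<exists>a b. x = Old a \<and> y = Old b \<and> (a, b) \<in> r)})"

definition Rees :: "'a rel \<Rightarrow> 'b rel \<Rightarrow> ('a \<times> 'b) adjoined rel" where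
  "Rees P Q = adjoin_bounds (rees_product (Restr P (Field P - {zero_hat P})) Q)"

text \<open>
  \<open>tree t m\<close> is \<open>T\<^bsub>t,m\<^esub>\<close>, the \<open>t\<close>-ary tree of rank \<open>m - 1\<close>: its elements are the words of length
  less than \<open>m\<close> over the alphabet \<open>{0, \<dots>, t - 1}\<close>, the word length being the rank, and the order is
  the prefix order.
\<close>

definition tree :: "nat \<Rightarrow> nat \<Rightarrow> nat list rel" where
  "tree t m =
     (let A = {u. length u < m \<and> set u \<subseteq> {..<t}}
      in {(u, v) \<in> A \<times> A. prefix u v})"

definition bracket :: "nat \<Rightarrow> nat \<Rightarrow> nat" where
  "bracket t k = (\<Sum>i<k. t ^ i)"

definition weight :: "nat \<Rightarrow> nat set \<Rightarrow> nat" where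
  "weight t S =
     (let s = sorted_list_of_set S
      in if S = {} then 1
         else bracket t (s ! 0) * (\<Prod>i = 1..<card S. bracket t (s ! i - s ! (i - 1) + 1)))"

lemma rank_of_eq_card:
  assumes "finite (Field r)" "Refl r" "x \<in> Field r"
  obtains C where "C \<in> Chains r" "x \<in> C" "\<forall>y\<in>C. (y, x) \<in> r" "card C = rank_of r x + 1"
    "\<forall>D\<in>Chains r. x \<in> D \<longrightarrow> (\<forall>y\<in>D. (y, x) \<in> r) \<longrightarrow> card D \<le> card C"
proof -
  let ?K = "{C. C \<in> Chains r \<and> x \<in> C \<and> (\<forall>y\<in>C. (y, x) \<in> r)}"
  let ?A = "{card C - 1 | C. C \<in> Chains r \<and> x \<in> C \<and> (\<forall>y\<in>C. (y, x) \<in> r)}"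
  have sub: "?K \<subseteq> Pow (Field r)"
    by (auto simp: Chains_def Field_def)
  have finK: "finite ?K"
    using finite_subset[OF sub] assms(1) by simp
  have A: "?A = (\<lambda>C. card C - 1) ` ?K"
    by auto
  have xx: "(x, x) \<in> r"
    using assms(2,3) by (auto simp: refl_on_def)
  have ne: "{x} \<in> ?K"
    using xx by (auto simp: Chains_def)
  have finC: "finite C" if "C \<in> ?K" for C
    using that sub assms(1) by (meson PowD finite_subset subsetD)
  have finA: "finite ?A"
    unfolding A using finK by (rule finite_imageI)
  have neA: "?A \<noteq> {}"
    unfolding A using ne by blast
  have "rank_of r x \<in> ?A"
    unfolding rank_of_def by (rule Max_in[OF finA neA])
  then obtain C where C: "C \<in> ?K" "rank_of r x = card C - 1"
    unfolding A by blast
  have pos: "card D > 0" if "D \<in> ?K" for D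
    using that finC[OF that] by (auto simp: card_gt_0_iff)
  have "card D \<le> card C" if "D \<in> ?K" for D
  proof -
    have "card D - 1 \<in> ?A" using that by blast
    then have "card D - 1 \<le> rank_of r x"
      unfolding rank_of_def by (rule Max_ge[OF finA])
    with C(2) pos[OF that] pos[OF C(1)] show ?thesis by linarith
  qed
  with C pos[OF C(1)] show thesis
    by (intro that[of C]) (blast | simp)+
qed

lemma chain_in_maximal_chain:
  assumes "finite (Field r)" "C \<in> Chains r"
  obtains M where "M \<in> maximal_chains r" "C \<subseteq> M"
proof -
  have "Chains r \<subseteq> Pow (Field r)"
    by (auto simp: Chains_def Field_def)
  then have "finite (Chains r)"
    using assms(1) by (simp add: finite_subset)
  then obtain M where "M \<in> Chains r" "C \<subseteq> M" "\<forall>D \<in> Chains r. M \<subseteq> D \<longrightarrow> D = M"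
    using finite_has_maximal2[OF _ assms(2)] by metis
  then show thesis
    by (intro that[of M]) (auto simp: maximal_chains_def)
qed

lemma rank_of_zero_hat:
  assumes "graded r"
  shows "rank_of r (zero_hat r) = 0"
proof -
  let ?z = "zero_hat r"
  have fin: "finite (Field r)" and refl: "Refl r" and ex: "\<exists>!x. minimal_in r x"
    using assms by (auto simp: graded_def partial_order_on_def preorder_on_def)
  have z: "minimal_in r ?z"
    unfolding zero_hat_def by (rule theI'[OF ex])
  then have "?z \<in> Field r" by (simp add: minimal_in_def)
  then obtain C where C: "?z \<in> C" "\<forall>y\<in>C. (y, ?z) \<in> r" "card C = rank_of r ?z + 1"
    using rank_of_eq_card[OF fin refl] by metis
  have "C = {?z}"
    using C(1,2) z by (auto simp: minimal_in_def)
  with C(3) show ?thesis by simp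
qed

lemma rank_of_covers:
  assumes "graded r" "strictly_below r x y"
    and no: "\<not> (\<exists>z. strictly_below r x z \<and> strictly_below r z y)"
  shows "rank_of r y = rank_of r x + 1"
proof -
  have fin: "finite (Field r)" and refl: "Refl r" and tr: "trans r" and asym: "antisym r"
    using assms(1) by (simp_all add: graded_def partial_order_on_def preorder_on_def)
  have len: "card C = card D" if "C \<in> maximal_chains r" "D \<in> maximal_chains r" for C D
    using assms(1) that unfolding graded_def by blast
  have xy: "(x, y) \<in> r" "x \<noteq> y" and mem: "x \<in> Field r" "y \<in> Field r"
    using assms(2) by (auto simp: strictly_below_def Field_def)
  have rf: "(a, a) \<in> r" if "a \<in> Field r" for a
    using refl that by (auto simp: refl_on_def)
  have sub: "C \<subseteq> Field r" if "C \<in> Chains r" for C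
    using that by (auto simp: Chains_def Field_def)
  obtain C where C: "C \<in> Chains r" "x \<in> C" "\<forall>u\<in>C. (u, x) \<in> r" "card C = rank_of r x + 1"
      "\<forall>D\<in>Chains r. x \<in> D \<longrightarrow> (\<forall>u\<in>D. (u, x) \<in> r) \<longrightarrow> card D \<le> card C"
    using rank_of_eq_card[OF fin refl mem(1)] .
  obtain D where D: "D \<in> Chains r" "y \<in> D" "\<forall>u\<in>D. (u, y) \<in> r" "card D = rank_of r y + 1"
      "\<forall>E\<in>Chains r. y \<in> E \<longrightarrow> (\<forall>u\<in>E. (u, y) \<in> r) \<longrightarrow> card E \<le> card D"
    using rank_of_eq_card[OF fin refl mem(2)] .
  obtain M where M: "M \<in> maximal_chains r" "D \<subseteq> M"
    using chain_in_maximal_chain[OF fin D(1)] .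
  have Mch: "M \<in> Chains r" using M(1) by (simp add: maximal_chains_def)
  have Mcmp: "(a, b) \<in> r \<or> (b, a) \<in> r" if "a \<in> M" "b \<in> M" for a b
    using Mch that by (auto simp: Chains_def)
  define U where "U = {u \<in> M. (y, u) \<in> r \<and> u \<noteq> y}"
  have finM: "finite M" using sub[OF Mch] fin finite_subset by blast
  have finC: "finite C" using sub[OF C(1)] fin finite_subset by blast
  have finD: "finite D" using M(2) finM finite_subset by blast
  have "card {u \<in> M. (u, y) \<in> r} \<le> card D"
    using Mcmp M(2) D(2) rf[OF mem(2)] by (intro D(5)[rule_format]) (auto simp: Chains_def)
  moreover have "D \<subseteq> {u \<in> M. (u, y) \<in> r}"
    using M(2) D(3) by auto
  ultimately have Deq: "D = {u \<in> M. (u, y) \<in> r}"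
    using finM by (intro card_seteq) auto
  have "M = D \<union> U" "D \<inter> U = {}"
    using Deq Mcmp M(2) D(2) asym unfolding U_def antisym_def by blast+
  then have cM: "card M = card D + card U"
    using finM finD by (simp add: card_Un_disjoint)
  define N where "N = insert y (C \<union> U)"
  have CU: "(c, u) \<in> r" if "c \<in> C" "u \<in> insert y U" for c u
    using that C(3) xy(1) tr unfolding U_def by (blast dest: transD)
  have Nch: "N \<in> Chains r"
    unfolding Chains_def N_def
    using C(1) Mcmp CU rf[OF mem(2)] by (auto simp: Chains_def U_def)
  have yC: "y \<notin> C" using C(3) xy asym by (auto simp: antisym_def)
  have "y \<notin> U" by (simp add: U_def)
  moreover have "C \<inter> U = {}"
    using C(3) xy asym tr unfolding U_def antisym_def by (blast dest: transD)
  ultimately have cN: "card N = card C + card U + 1"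
    using yC finC finM by (simp add: N_def U_def card_Un_disjoint)
  have "E = N" if E: "E \<in> Chains r" "N \<subseteq> E" for E
  proof -
    have Ecmp: "(a, b) \<in> r \<or> (b, a) \<in> r" if "a \<in> E" "b \<in> E" for a b
      using E(1) that by (auto simp: Chains_def)
    have "z \<in> N" if z: "z \<in> E" for z
    proof -
      have xE: "x \<in> E" and yE: "y \<in> E" using E(2) C(2) by (auto simp: N_def)
      consider "(z, x) \<in> r" | "(y, z) \<in> r" | "(x, z) \<in> r" "z \<noteq> x" "(z, y) \<in> r" "z \<noteq> y"
        using Ecmp[OF z xE] Ecmp[OF z yE] rf[OF mem(1)] rf[OF mem(2)] by blast
      then show ?thesis
      proof cases
        case 1
        have "card (insert z C) \<le> card C"
        proof (rule C(5)[rule_format])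
          show "insert z C \<in> Chains r"
            using E z Ecmp unfolding Chains_def N_def by blast
        qed (use C(2,3) 1 in auto)
        then have "z \<in> C"
          using finC by (cases "z \<in> C") auto
        then show ?thesis by (simp add: N_def)
      next
        case 2
        have DE: "(d, z) \<in> r" if "d \<in> D" for d
          using that D(3) 2 tr by (blast dest: transD)
        have "insert z M \<in> Chains r"
        proof -
          have "(a, z) \<in> r \<or> (z, a) \<in> r" if "a \<in> M" for a
            using that \<open>M = D \<union> U\<close> DE Ecmp[OF z] E(2) unfolding N_def by blast
          moreover have "(z, z) \<in> r" using Ecmp[OF z z] by blast
          ultimately show ?thesis
            using Mcmp unfolding Chains_def by blast
        qed
        then have "insert z M = M"
          using M(1) by (auto simp: maximal_chains_def)
        then have "z \<in> M" by blast
        with 2 show ?thesis by (auto simp: N_def U_def)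
      next
        case 3
        with no show ?thesis by (auto simp: strictly_below_def)
      qed
    qed
    with E(2) show ?thesis by blast
  qed
  with Nch have "N \<in> maximal_chains r"
    by (simp add: maximal_chains_def)
  from len[OF this M(1)] cM cN C(4) D(4) show ?thesis by linarith
qed

end

theory Submission
  imports Defs
begin

text \<open>
  Write \<open>R\<close> for the Rees product and \<open>\<rho>\<close> for the rank function of \<open>P\<close>. In \<open>R\<close> an element \<open>(p, q)\<close> has
  rank \<open>\<rho> p\<close>: a strict step in \<open>R\<close> forces a strict step in \<open>P\<close>, which bounds the rank from above, and
  a longest chain of \<open>P\<close> below \<open>p\<close> lifts to \<open>R\<close> by pairing each of its elements with a prefix of the
  word \<open>q\<close>, no longer than the rank of the element permits (\<open>rank_Rees\<close>).

  Hence a chain of \<open>R\<close> with rank set \<open>S\<close> is a chain \<open>p\<^sub>1 < \<dots> < p\<^sub>k\<close> of \<open>P\<close> with rank set \<open>S\<close>, decorated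
  with words \<open>q\<^sub>1, \<dots>, q\<^sub>k\<close>. The order of the Rees product says that \<open>q\<^sub>1\<close> has length less than \<open>s\<^sub>1\<close> and
  that \<open>q\<^sub>i\<close> extends the previous word by at most \<open>s\<^sub>i - s\<^bsub>i-1\<^esub>\<close> letters. In the \<open>t\<close>-ary tree this leaves
  \<open>[s\<^sub>1]\<close> choices for \<open>q\<^sub>1\<close> and \<open>[s\<^sub>i - s\<^bsub>i-1\<^esub> + 1]\<close> choices for \<open>q\<^sub>i\<close> whatever the earlier words are
  (\<open>card_extensions\<close>). The product of these numbers is the weight of \<open>S\<close>, and the factorisation follows
  by induction on the list of ranks (\<open>card_chains_from_Old\<close>, \<open>card_chains_from_New_Zero\<close>).

  The rank \<open>n + 1\<close> is attained in \<open>P\<close> only at the top element. So a chain of \<open>P\<close> with rank set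
  \<open>S \<union> {n + 1}\<close> is one with rank set \<open>S\<close> followed by the top element, which explains why
  \<^term>\<open>flag_f P S\<close> occurs in both formulas.
\<close>

section \<open>Rank in finite posets\<close>

lemma Partial_orderI: "Refl r \<Longrightarrow> trans r \<Longrightarrow> antisym r \<Longrightarrow> Partial_order r"
  by (auto simp: partial_order_on_def preorder_on_def intro: FieldI1 FieldI2)

lemma rank_of_less:
  assumes "finite (Field r)" "Partial_order r" "strictly_below r x y"
  shows "rank_of r x < rank_of r y"
proof -
  have refl: "Refl r" and tr: "trans r" and asym: "antisym r"
    using assms(2) by (simp_all add: partial_order_on_def preorder_on_def)
  have xy: "(x, y) \<in> r" "x \<noteq> y" and mem: "x \<in> Field r" "y \<in> Field r"
    using assms(3) by (auto simp: strictly_below_def Field_def)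
  have yy: "(y, y) \<in> r" using refl mem by (auto simp: refl_on_def)
  obtain C where C: "C \<in> Chains r" "x \<in> C" "\<forall>u\<in>C. (u, x) \<in> r" "card C = rank_of r x + 1"
    using rank_of_eq_card[OF assms(1) refl mem(1)] by metis
  obtain D where D: "D \<in> Chains r" "y \<in> D" "\<forall>u\<in>D. (u, y) \<in> r" "card D = rank_of r y + 1"
      "\<forall>E\<in>Chains r. y \<in> E \<longrightarrow> (\<forall>u\<in>E. (u, y) \<in> r) \<longrightarrow> card E \<le> card D"
    using rank_of_eq_card[OF assms(1) refl mem(2)] .
  have finC: "finite C"
    using C(4) card.infinite by fastforce
  have below: "(u, y) \<in> r" if "u \<in> C" for u
    using that C(3) xy(1) tr by (blast dest: transD)
  have "y \<notin> C" using C(3) xy asym by (auto simp: antisym_def)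
  then have "card (insert y C) = rank_of r x + 2"
    using finC C(4) by simp
  moreover have "insert y C \<in> Chains r"
    using C(1) below yy by (auto simp: Chains_def)
  then have "card (insert y C) \<le> card D"
    using below yy by (intro D(5)[rule_format]) auto
  ultimately show ?thesis using D(4) by simp
qed

text \<open>
  A strictly increasing function \<open>f\<close> is injective on a chain below \<open>x\<close> and maps it into
  \<open>{0, \<dots>, f x}\<close>, so no such chain has more than \<open>f x + 1\<close> elements; one chain of that size is enough.
  This yields the ranks in the tree, in \<open>P\<close> without its least element, and in the Rees product.
\<close>

lemma rank_of_eqI:
  assumes "finite (Field r)" "Refl r"
    and mono: "\<And>u v. strictly_below r u v \<Longrightarrow> f u < f v"
    and C: "C \<in> Chains r" "x \<in> C" "\<And>y. y \<in> C \<Longrightarrow> (y, x) \<in> r" "card C = f x + 1"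
  shows "rank_of r x = f x"
proof -
  have "x \<in> Field r" using C(2,3) by (auto simp: Field_def)
  then obtain D where D: "D \<in> Chains r" "\<forall>y\<in>D. (y, x) \<in> r" "card D = rank_of r x + 1"
      "\<forall>E\<in>Chains r. x \<in> E \<longrightarrow> (\<forall>y\<in>E. (y, x) \<in> r) \<longrightarrow> card E \<le> card D"
    using rank_of_eq_card[OF assms(1,2)] by metis
  have "card C \<le> card D"
    using D(4) C by blast
  moreover have "inj_on f D"
  proof (rule inj_onI, rule ccontr)
    fix u v assume "u \<in> D" "v \<in> D" "f u = f v" "u \<noteq> v"
    with D(1) have "strictly_below r u v \<or> strictly_below r v u"
      by (auto simp: Chains_def strictly_below_def)
    with mono \<open>f u = f v\<close> show False by fastforce
  qed
  moreover have "f ` D \<subseteq> {..f x}"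
    using D(2) mono by (force simp: strictly_below_def)
  ultimately have "card D \<le> f x + 1"
    using card_inj_on_le[of f D "{..f x}"] by simp
  with \<open>card C \<le> card D\<close> C(4) D(3) show ?thesis by simp
qed

lemma zero_hat_least:
  assumes "graded r" "x \<in> Field r"
  shows "(zero_hat r, x) \<in> r"
proof -
  have fin: "finite (Field r)" and po: "Partial_order r" and ex: "\<exists>!x. minimal_in r x"
    using assms(1) by (auto simp: graded_def)
  have "finite {y. (y, x) \<in> r}"
    by (rule finite_subset[OF _ fin]) (auto simp: Field_def)
  moreover have "(x, x) \<in> r"
    using po assms(2) by (auto simp: partial_order_on_def preorder_on_def refl_on_def)
  ultimately obtain y where y: "(y, x) \<in> r" "\<And>z. (z, x) \<in> r \<Longrightarrow> rank_of r y \<le> rank_of r z"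
    using arg_min_if_finite[of "{y. (y, x) \<in> r}" "rank_of r"]
    by (metis (mono_tags, lifting) emptyE leI mem_Collect_eq)
  have "minimal_in r y"
    unfolding minimal_in_def
  proof (intro conjI allI impI)
    show "y \<in> Field r" using y(1) by (auto simp: Field_def)
    fix z assume z: "(z, y) \<in> r"
    then have "(z, x) \<in> r"
      using y(1) po by (auto simp: partial_order_on_def preorder_on_def dest: transD)
    with y(2) rank_of_less[OF fin po, of z y] z show "z = y"
      by (fastforce simp: strictly_below_def)
  qed
  then have "zero_hat r = y"
    unfolding zero_hat_def using ex by (blast intro: the1_equality)
  with y(1) show ?thesis by simp
qed

lemma one_hat_greatest:
  assumes "graded r" "x \<in> Field r"
  shows "(x, one_hat r) \<in> r"
proof -
  have fin: "finite (Field r)" and po: "Partial_order r" and ex: "\<exists>!x. maximal_in r x"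
    using assms(1) by (auto simp: graded_def)
  have "finite {y. (x, y) \<in> r}"
    by (rule finite_subset[OF _ fin]) (auto simp: Field_def)
  moreover have "(x, x) \<in> r"
    using po assms(2) by (auto simp: partial_order_on_def preorder_on_def refl_on_def)
  ultimately have "Max (rank_of r ` {y. (x, y) \<in> r}) \<in> rank_of r ` {y. (x, y) \<in> r}"
    by (intro Max_in) auto
  then obtain y where y: "(x, y) \<in> r" "rank_of r y = Max (rank_of r ` {y. (x, y) \<in> r})"
    by auto
  have top: "rank_of r z \<le> rank_of r y" if "(x, z) \<in> r" for z
    unfolding y(2) using \<open>finite {y. (x, y) \<in> r}\<close> that by (intro Max_ge) auto
  have "maximal_in r y"
    unfolding maximal_in_def
  proof (intro conjI allI impI)
    show "y \<in> Field r" using y(1) by (auto simp: Field_def)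
    fix z assume z: "(y, z) \<in> r"
    then have "(x, z) \<in> r"
      using y(1) po by (auto simp: partial_order_on_def preorder_on_def dest: transD)
    with top[of z] rank_of_less[OF fin po, of y z] z show "z = y"
      by (fastforce simp: strictly_below_def)
  qed
  then have "one_hat r = y"
    unfolding one_hat_def using ex by (blast intro: the1_equality)
  with y(1) show ?thesis by simp
qed

section \<open>Chains with prescribed ranks\<close>

definition chains_from :: "'a rel \<Rightarrow> 'a \<Rightarrow> nat list \<Rightarrow> 'a list set" where
  "chains_from r x ss =
     {xs. sorted_wrt (strictly_below r) (x # xs) \<and> map (rank_of r) xs = ss}"

lemma chains_from_Nil: "chains_from r x [] = {[]}"
  by (auto simp: chains_from_def)

lemma transp_strictly_below: "Partial_order r \<Longrightarrow> transp (strictly_below r)"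
  unfolding transp_def strictly_below_def partial_order_on_def preorder_on_def
  by (blast dest: transD antisymD)

lemma finite_strictly_above: "finite (Field r) \<Longrightarrow> finite {y. strictly_below r x y \<and> Q y}"
  by (rule finite_subset[of _ "Field r"]) (auto simp: strictly_below_def Field_def)

lemma finite_chains_from:
  assumes "finite (Field r)"
  shows "finite (chains_from r x ss)"
proof (rule finite_subset)
  show "chains_from r x ss \<subseteq> {xs. set xs \<subseteq> Field r \<and> length xs = length ss}"
    by (force simp: chains_from_def strictly_below_def Field_def)
qed (use assms in \<open>rule finite_lists_length_eq\<close>)

lemma card_chains_from_Cons:
  assumes "finite (Field r)" "Partial_order r"
  shows "card (chains_from r x (s # ss)) =
    (\<Sum>y | strictly_below r x y \<and> rank_of r y = s. card (chains_from r y ss))"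
proof -
  let ?B = "{y. strictly_below r x y \<and> rank_of r y = s}"
  have "chains_from r x (s # ss) = (\<Union>y\<in>?B. (#) y ` chains_from r y ss)"
  proof (intro equalityI subsetI)
    fix xs assume "xs \<in> chains_from r x (s # ss)"
    then show "xs \<in> (\<Union>y\<in>?B. (#) y ` chains_from r y ss)"
      by (cases xs) (auto simp: chains_from_def)
  next
    fix xs assume "xs \<in> (\<Union>y\<in>?B. (#) y ` chains_from r y ss)"
    then show "xs \<in> chains_from r x (s # ss)"
      using transp_strictly_below[OF assms(2)]
      by (auto simp: chains_from_def dest: transpD)
  qed
  also have "card \<dots> = (\<Sum>y\<in>?B. card ((#) y ` chains_from r y ss))"
    by (rule card_UN_disjoint)
      (auto simp: finite_strictly_above finite_chains_from assms(1))
  also have "\<dots> = (\<Sum>y\<in>?B. card (chains_from r y ss))"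
    by (simp add: card_image)
  finally show ?thesis .
qed

text \<open>
  Being strictly below the top, as required in \<^const>\<open>flag_f\<close>, is automatic for elements whose rank is
  smaller than the rank of the poset.
\<close>

lemma flag_f_eq_card_chains_from:
  assumes "finite (Field r)" "Partial_order r"
    and greatest: "\<And>x. x \<in> Field r \<Longrightarrow> (x, one_hat r) \<in> r"
    and "zero_hat r \<in> Field r" "zero_hat r \<noteq> one_hat r"
    and S: "finite S" "\<And>s. s \<in> S \<Longrightarrow> s < poset_rank r"
  shows "flag_f r S = card (chains_from r (zero_hat r) (sorted_list_of_set S))"
proof -
  have "sorted_wrt (strictly_below r) (zero_hat r # xs @ [one_hat r])"
    if xs: "sorted_wrt (strictly_below r) (zero_hat r # xs)"
      and ranks: "map (rank_of r) xs = sorted_list_of_set S" for xs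
  proof -
    have "strictly_below r x (one_hat r)" if "x \<in> set xs" for x
    proof -
      have "rank_of r x \<in> set (sorted_list_of_set S)"
        using that by (simp flip: ranks)
      then have "rank_of r x < poset_rank r" using S by simp
      moreover have "x \<in> Field r"
        using xs that by (auto simp: strictly_below_def Field_def)
      ultimately show ?thesis
        using greatest by (auto simp: strictly_below_def poset_rank_def)
    qed
    moreover have "strictly_below r (zero_hat r) (one_hat r)"
      using assms(3-5) by (simp add: strictly_below_def)
    ultimately show ?thesis using xs by (auto simp: sorted_wrt_append)
  qed
  then have "{xs. sorted_wrt (strictly_below r) (zero_hat r # xs @ [one_hat r])
      \<and> map (rank_of r) xs = sorted_list_of_set S}
    = chains_from r (zero_hat r) (sorted_list_of_set S)"
    unfolding chains_from_def by (auto simp: sorted_wrt_append)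
  then show ?thesis by (simp add: flag_f_def)
qed

lemma flag_f_graded:
  assumes "graded r" "finite S" "\<And>s. s \<in> S \<Longrightarrow> s < poset_rank r" "poset_rank r > 0"
  shows "flag_f r S = card (chains_from r (zero_hat r) (sorted_list_of_set S))"
proof (rule flag_f_eq_card_chains_from)
  show "finite (Field r)" "Partial_order r"
    using assms(1) by (simp_all add: graded_def)
  show "zero_hat r \<in> Field r"
    using assms(1) theI'[of "minimal_in r"] by (simp add: graded_def zero_hat_def minimal_in_def)
  show "zero_hat r \<noteq> one_hat r"
    using assms(4) rank_of_zero_hat[OF assms(1)] by (auto simp: poset_rank_def)
qed (use assms one_hat_greatest in auto)

text \<open>The top element is the only one whose rank is the rank of the poset.\<close>

lemma card_chains_from_snoc_poset_rank:
  assumes "graded r" "x \<in> Field r" "rank_of r x < poset_rank r"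
    and ss: "\<And>s. s \<in> set ss \<Longrightarrow> s < poset_rank r"
  shows "card (chains_from r x (ss @ [poset_rank r])) = card (chains_from r x ss)"
proof -
  have po: "finite (Field r)" "Partial_order r"
    using assms(1) by (simp_all add: graded_def)
  have top: "y = one_hat r" if "y \<in> Field r" "rank_of r y = poset_rank r" for y
    using one_hat_greatest[OF assms(1) that(1)] rank_of_less[OF po, of y "one_hat r"] that(2)
    by (force simp: strictly_below_def poset_rank_def)
  have below: "strictly_below r y (one_hat r)" if "y \<in> Field r" "rank_of r y < poset_rank r" for y
    using one_hat_greatest[OF assms(1) that(1)] that(2)
    by (auto simp: strictly_below_def poset_rank_def)
  have "chains_from r x (ss @ [poset_rank r]) = (\<lambda>xs. xs @ [one_hat r]) ` chains_from r x ss"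
  proof (intro equalityI subsetI)
    fix ys assume ys: "ys \<in> chains_from r x (ss @ [poset_rank r])"
    then have "map (rank_of r) ys = ss @ [poset_rank r]" by (simp add: chains_from_def)
    then obtain xs y where "ys = xs @ [y]" "map (rank_of r) xs = ss" "rank_of r y = poset_rank r"
      by (auto simp: map_eq_append_conv)
    moreover from this ys have "y = one_hat r"
      by (intro top) (auto simp: chains_from_def sorted_wrt_append strictly_below_def Field_def)
    ultimately show "ys \<in> (\<lambda>xs. xs @ [one_hat r]) ` chains_from r x ss"
      using ys by (auto simp: chains_from_def sorted_wrt_append)
  next
    fix ys assume "ys \<in> (\<lambda>xs. xs @ [one_hat r]) ` chains_from r x ss"
    then obtain xs where xs: "ys = xs @ [one_hat r]" "sorted_wrt (strictly_below r) (x # xs)"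
        "map (rank_of r) xs = ss"
      by (auto simp: chains_from_def)
    have "strictly_below r y (one_hat r)" if "y \<in> set xs" for y
    proof (rule below)
      show "y \<in> Field r" using xs(2) that by (auto simp: strictly_below_def Field_def)
      show "rank_of r y < poset_rank r" using ss that by (simp flip: xs(3))
    qed
    moreover have "strictly_below r x (one_hat r)" using below assms(2,3) by simp
    ultimately show "ys \<in> chains_from r x (ss @ [poset_rank r])"
      using xs by (auto simp: chains_from_def sorted_wrt_append poset_rank_def)
  qed
  then show ?thesis by (simp add: card_image inj_on_def)
qed

section \<open>Weights and words\<close>

text \<open>
  The weight of a list of ranks that continues from the rank \<open>s\<close>. The first factor of
  \<^const>\<open>weight\<close> is the general factor with previous rank 1: atoms have rank 0 once the least element
  of \<open>P\<close> is removed, so a word next to an element of rank \<open>s\<close> has at most \<open>s - 1\<close> letters.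
\<close>

fun list_weight :: "nat \<Rightarrow> nat \<Rightarrow> nat list \<Rightarrow> nat" where
  "list_weight t s [] = 1"
| "list_weight t s (s' # ss) = bracket t (s' - s + 1) * list_weight t s' ss"

lemma list_weight_eq_prod:
  "list_weight t s ss = (\<Prod>i<length ss. bracket t ((s # ss) ! Suc i - (s # ss) ! i + 1))"
  by (induction ss arbitrary: s) (simp_all add: prod.lessThan_Suc_shift del: prod.lessThan_Suc)

lemma weight_eq_list_weight:
  assumes "finite S" "0 \<notin> S"
  shows "weight t S = list_weight t 1 (sorted_list_of_set S)"
proof (cases "sorted_list_of_set S")
  case Nil
  then show ?thesis using assms(1) by (simp add: weight_def)
next
  case (Cons s ss)
  have "s > 0"
    using assms Cons set_sorted_list_of_set[OF assms(1)] by (metis gr0I list.set_intros(1))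
  have "S \<noteq> {}" using Cons by auto
  have card: "card S = Suc (length ss)"
    using Cons length_sorted_list_of_set[of S] by simp
  have "weight t S = bracket t s * (\<Prod>i = 1..<Suc (length ss). bracket t ((s # ss) ! i - (s # ss) ! (i - 1) + 1))"
    using \<open>S \<noteq> {}\<close> by (simp only: weight_def Cons card Let_def if_False nth_Cons_0)
  also have "(\<Prod>i = 1..<Suc (length ss). bracket t ((s # ss) ! i - (s # ss) ! (i - 1) + 1))
      = list_weight t s ss"
    unfolding list_weight_eq_prod
    by (rule prod.reindex_bij_witness[of _ Suc "\<lambda>i. i - 1"]) auto
  finally show ?thesis using \<open>s > 0\<close> by (simp add: Cons)
qed

definition extensions :: "nat \<Rightarrow> nat list \<Rightarrow> nat \<Rightarrow> nat list set" where
  "extensions t q d = {q'. prefix q q' \<and> set q' \<subseteq> {..<t} \<and> length q' \<le> length q + d}"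

lemma card_extensions:
  assumes "set q \<subseteq> {..<t}"
  shows "card (extensions t q d) = bracket t (d + 1)"
proof -
  have "extensions t q d = (@) q ` {u. set u \<subseteq> {..<t} \<and> length u \<le> d}"
    using assms by (auto simp: extensions_def prefix_def)
  then have "card (extensions t q d) = card {u. set u \<subseteq> {..<t} \<and> length u \<le> d}"
    by (simp add: card_image inj_on_def)
  also have "\<dots> = bracket t (d + 1)"
    by (simp add: card_lists_length_le bracket_def lessThan_Suc_atMost)
  finally show ?thesis .
qed

lemma Field_tree: "Field (tree t m) = {u. length u < m \<and> set u \<subseteq> {..<t}}"
  by (auto simp: tree_def Field_def)

lemma tree_partial_order: "finite (Field (tree t m))" "Partial_order (tree t m)"
proof -
  have "finite {u. set u \<subseteq> {..<t} \<and> length u \<le> m}" by (simp add: finite_lists_length_le)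
  then show "finite (Field (tree t m))"
    unfolding Field_tree by (rule rev_finite_subset) auto
  show "Partial_order (tree t m)"
    unfolding partial_order_on_def preorder_on_def refl_on_def Field_tree
    by (auto simp: tree_def intro!: transI antisymI)
qed

lemma rank_of_tree:
  assumes "u \<in> Field (tree t m)"
  shows "rank_of (tree t m) u = length u"
proof (rule rank_of_eqI)
  show "finite (Field (tree t m))" "Refl (tree t m)"
    using tree_partial_order by (auto simp: partial_order_on_def preorder_on_def)
  show "length v < length w" if "strictly_below (tree t m) v w" for v w
    using that by (auto simp: strictly_below_def tree_def strict_prefix_def intro: prefix_length_less)
  let ?C = "set (prefixes u)"
  show "(v, u) \<in> tree t m" if "v \<in> ?C" for v
    using that assms unfolding Field_tree by (auto simp: tree_def dest: prefix_length_le set_mono_prefix)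
  then show "?C \<in> Chains (tree t m)"
    by (auto simp: Chains_def tree_def dest: prefix_same_cases)
  show "card ?C = length u + 1"
    by (simp add: distinct_card)
qed simp

section \<open>The order of the Rees product\<close>

lemma rees_product_partial_order:
  assumes "finite (Field P)" "Partial_order P" "finite (Field Q)" "Partial_order Q"
  shows "finite (Field (rees_product P Q))" "Partial_order (rees_product P Q)"
proof -
  have P: "\<And>x. x \<in> Field P \<Longrightarrow> (x, x) \<in> P" "trans P" "antisym P"
    and Q: "\<And>x. x \<in> Field Q \<Longrightarrow> (x, x) \<in> Q" "trans Q" "antisym Q"
    using assms by (auto simp: partial_order_on_def preorder_on_def refl_on_def)
  have "Field (rees_product P Q) \<subseteq> Field P \<times> Field Q"
    by (auto simp: rees_product_def Field_def)
  then show "finite (Field (rees_product P Q))"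
    using assms(1,3) finite_subset by blast
  have "Refl (rees_product P Q)"
  proof (rule refl_onI)
    fix x assume "x \<in> Field (rees_product P Q)"
    then show "(x, x) \<in> rees_product P Q"
      by (auto simp: rees_product_def Field_def intro: P(1) Q(1) FieldI1 FieldI2)
  qed
  moreover have "trans (rees_product P Q)"
    using P(2) Q(2) by (intro transI) (auto simp: rees_product_def dest: transD)
  moreover have "antisym (rees_product P Q)"
    using P(3) Q(3) by (intro antisymI) (auto simp: rees_product_def dest: antisymD)
  ultimately show "Partial_order (rees_product P Q)"
    by (rule Partial_orderI)
qed

lemma Field_adjoin_bounds:
  "Field (adjoin_bounds r) = {New_Zero, New_One} \<union> Old ` Field r"
  by (force simp: adjoin_bounds_def Let_def Field_def)

lemma adjoin_bounds_simps [simp]: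
  "(New_Zero, y) \<in> adjoin_bounds r \<longleftrightarrow> y \<in> Field (adjoin_bounds r)"
  "(x, New_One) \<in> adjoin_bounds r \<longleftrightarrow> x \<in> Field (adjoin_bounds r)"
  "(x, New_Zero) \<in> adjoin_bounds r \<longleftrightarrow> x = New_Zero"
  "(New_One, y) \<in> adjoin_bounds r \<longleftrightarrow> y = New_One"
  "(Old a, Old b) \<in> adjoin_bounds r \<longleftrightarrow> (a, b) \<in> r"
  unfolding Field_adjoin_bounds
  by (auto simp: adjoin_bounds_def Let_def intro: FieldI1 FieldI2)

lemma adjoin_bounds_partial_order:
  assumes "finite (Field r)" "Partial_order r"
  shows "finite (Field (adjoin_bounds r))" "Partial_order (adjoin_bounds r)"
proof -
  let ?A = "adjoin_bounds r"
  have r: "\<And>x. x \<in> Field r \<Longrightarrow> (x, x) \<in> r" "trans r" "antisym r"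
    using assms by (auto simp: partial_order_on_def preorder_on_def refl_on_def)
  show "finite (Field ?A)" using assms(1) by (simp add: Field_adjoin_bounds)
  have "Refl ?A"
    by (rule refl_onI) (auto simp: Field_adjoin_bounds r(1))
  moreover have "trans ?A"
  proof (rule transI)
    fix x y z assume "(x, y) \<in> ?A" "(y, z) \<in> ?A"
    then show "(x, z) \<in> ?A"
      by (cases x; cases y; cases z) (auto simp: Field_adjoin_bounds dest: transD[OF r(2)] FieldI2 FieldI1)
  qed
  moreover have "antisym ?A"
  proof (rule antisymI)
    fix x y assume "(x, y) \<in> ?A" "(y, x) \<in> ?A"
    then show "x = y" by (cases x; cases y) (auto dest: antisymD[OF r(3)])
  qed
  ultimately show "Partial_order ?A"
    by (rule Partial_orderI)
qed

lemma zero_hat_adjoin_bounds: "zero_hat (adjoin_bounds r) = New_Zero"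
  unfolding zero_hat_def
proof (rule the_equality)
  show "minimal_in (adjoin_bounds r) New_Zero"
    by (auto simp: minimal_in_def Field_adjoin_bounds)
  fix x assume "minimal_in (adjoin_bounds r) x"
  then show "x = New_Zero" unfolding minimal_in_def by (metis adjoin_bounds_simps(1))
qed

lemma one_hat_adjoin_bounds: "one_hat (adjoin_bounds r) = New_One"
  unfolding one_hat_def
proof (rule the_equality)
  show "maximal_in (adjoin_bounds r) New_One"
    by (auto simp: maximal_in_def Field_adjoin_bounds)
  fix x assume "maximal_in (adjoin_bounds r) x"
  then show "x = New_One" unfolding maximal_in_def by (metis adjoin_bounds_simps(2))
qed

section \<open>Rees products with trees\<close>

locale rees_tree =
  fixes P :: "'a rel" and n t :: nat
  assumes graded: "graded P" and rank_P: "poset_rank P = n + 1"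
begin

abbreviation R :: "('a \<times> nat list) adjoined rel" where
  "R \<equiv> Rees P (tree t (Suc n))"

abbreviation P_minus :: "'a rel" where
  "P_minus \<equiv> Restr P (Field P - {zero_hat P})"

lemma P_partial_order: "finite (Field P)" "Partial_order P"
  using graded by (simp_all add: graded_def)

lemma P_refl: "p \<in> Field P \<Longrightarrow> (p, p) \<in> P"
  using P_partial_order by (auto simp: partial_order_on_def preorder_on_def refl_on_def)

lemma rank_P_less: "strictly_below P p p' \<Longrightarrow> rank_of P p < rank_of P p'"
  by (rule rank_of_less[OF P_partial_order])

lemma rank_P_mono: "(p, p') \<in> P \<Longrightarrow> rank_of P p \<le> rank_of P p'"
  using rank_P_less[of p p'] by (cases "p = p'") (auto simp: strictly_below_def)

lemma rank_P_zero_iff: "p \<in> Field P \<Longrightarrow> rank_of P p = 0 \<longleftrightarrow> p = zero_hat P"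
  using rank_of_zero_hat[OF graded] zero_hat_least[OF graded, of p] rank_P_less[of "zero_hat P" p]
  by (cases "p = zero_hat P") (auto simp: strictly_below_def)

lemma rank_P_le: "p \<in> Field P \<Longrightarrow> rank_of P p \<le> n + 1"
  using rank_P_mono[OF one_hat_greatest[OF graded]] rank_P by (simp add: poset_rank_def)

lemma longest_chain_minus_zero:
  assumes "p \<in> Field P" "p \<noteq> zero_hat P"
  obtains C where "C \<in> Chains P" "p \<in> C" "\<And>y. y \<in> C \<Longrightarrow> (y, p) \<in> P" "zero_hat P \<notin> C"
    "card C = rank_of P p"
proof -
  obtain D where D: "D \<in> Chains P" "p \<in> D" "\<forall>y\<in>D. (y, p) \<in> P" "card D = rank_of P p + 1"
      "\<forall>E\<in>Chains P. p \<in> E \<longrightarrow> (\<forall>y\<in>E. (y, p) \<in> P) \<longrightarrow> card E \<le> card D"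
    using rank_of_eq_card[OF P_partial_order(1) _ assms(1)] P_partial_order(2)
    unfolding partial_order_on_def preorder_on_def by metis
  have fin: "finite D" using D(4) card.infinite by fastforce
  have DF: "D \<subseteq> Field P" using D(3) by (auto simp: Field_def)
  have zF: "zero_hat P \<in> Field P" using zero_hat_least[OF graded assms(1)] by (auto simp: Field_def)
  \<comment> \<open>A longest chain contains the least element, since otherwise it could be enlarged.\<close>
  have "insert (zero_hat P) D \<in> Chains P"
    using D(1) DF P_refl[OF zF] zero_hat_least[OF graded] by (auto simp: Chains_def)
  then have "card (insert (zero_hat P) D) \<le> card D"
    using D(2,3) zero_hat_least[OF graded assms(1)] by (intro D(5)[rule_format]) auto
  then have "zero_hat P \<in> D" using fin by (cases "zero_hat P \<in> D") auto
  then show thesis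
    using D fin assms(2) by (intro that[of "D - {zero_hat P}"]) (auto simp: Chains_def)
qed

lemma Field_P_minus: "Field P_minus = Field P - {zero_hat P}"
  using P_refl by (auto simp: Field_def)

lemma P_minus_partial_order: "finite (Field P_minus)" "Partial_order P_minus"
  using P_partial_order
  by (auto simp: Field_P_minus partial_order_on_def preorder_on_def refl_on_def
      trans_Restr intro: antisym_subset)

lemma rank_of_P_minus:
  assumes "p \<in> Field P" "p \<noteq> zero_hat P"
  shows "rank_of P_minus p = rank_of P p - 1"
proof -
  obtain C where C: "C \<in> Chains P" "p \<in> C" "\<And>y. y \<in> C \<Longrightarrow> (y, p) \<in> P" "zero_hat P \<notin> C"
    "card C = rank_of P p"
    using longest_chain_minus_zero[OF assms] by metis
  have CF: "C \<subseteq> Field P" using C(3) by (auto simp: Field_def)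
  show ?thesis
  proof (rule rank_of_eqI[where C = C])
    show "finite (Field P_minus)" "Refl P_minus"
      using P_minus_partial_order by (auto simp: partial_order_on_def preorder_on_def)
    show "rank_of P u - 1 < rank_of P v - 1" if "strictly_below P_minus u v" for u v
    proof -
      have "rank_of P u < rank_of P v" "rank_of P u \<noteq> 0"
        using that rank_P_less rank_P_zero_iff by (auto simp: strictly_below_def)
      then show ?thesis by simp
    qed
    show "C \<in> Chains P_minus" using C(1,4) CF by (auto simp: Chains_def)
    show "(y, p) \<in> P_minus" if "y \<in> C" for y
      using that C(3,4) CF assms by auto
    show "card C = rank_of P p - 1 + 1"
      using C(5) rank_P_zero_iff[OF assms(1)] assms(2) by simp
  qed (rule C(2))
qed

text \<open>
  Ranks in \<^term>\<open>P_minus\<close> are one less than in \<open>P\<close>, which turns the weak inequality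
  between ranks in the Rees product into \<open>length q < rank_of P p\<close>. That inequality also keeps the least
  element of \<open>P\<close> out, and keeps all words within the height of the tree.
\<close>

lemma rees_product_iff:
  "((p, q), (p', q')) \<in> rees_product P_minus (tree t (Suc n)) \<longleftrightarrow>
     (p, p') \<in> P \<and> length q < rank_of P p \<and> set q' \<subseteq> {..<t} \<and> prefix q q'
     \<and> length q' + rank_of P p \<le> length q + rank_of P p'"
  (is "?L \<longleftrightarrow> ?R")
proof
  assume L: ?L
  then have F: "p \<in> Field P" "p \<noteq> zero_hat P" "p' \<in> Field P" "p' \<noteq> zero_hat P"
      and q: "q \<in> Field (tree t (Suc n))" "q' \<in> Field (tree t (Suc n))"
    by (auto simp: rees_product_def Field_def)
  have "rank_of P p > 0" "rank_of P p' > 0" using F rank_P_zero_iff by auto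
  moreover have "set q' \<subseteq> {..<t}" "prefix q q'"
    using L by (auto simp: rees_product_def tree_def)
  ultimately show ?R
    using L by (auto simp: rees_product_def rank_of_P_minus[OF F(1,2)] rank_of_P_minus[OF F(3,4)]
        rank_of_tree[OF q(1)] rank_of_tree[OF q(2)])
next
  assume R: ?R
  then have F: "p \<in> Field P" "p' \<in> Field P" by (auto simp: Field_def)
  have pos: "rank_of P p > 0" "rank_of P p' > 0" using R rank_P_mono[of p p'] by auto
  then have nz: "p \<noteq> zero_hat P" "p' \<noteq> zero_hat P" using rank_of_zero_hat[OF graded] by auto
  have q: "q \<in> Field (tree t (Suc n))" "q' \<in> Field (tree t (Suc n))"
    using R rank_P_le[OF F(1)] rank_P_le[OF F(2)] by (auto simp: Field_tree dest: set_mono_prefix)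
  then have "(q, q') \<in> tree t (Suc n)" using R unfolding Field_tree by (simp add: tree_def)
  with R F nz pos show ?L
    by (auto simp: rees_product_def rank_of_P_minus[OF F(1) nz(1)] rank_of_P_minus[OF F(2) nz(2)]
        rank_of_tree[OF q(1)] rank_of_tree[OF q(2)])
qed

lemma Field_rees_product:
  "(p, q) \<in> Field (rees_product P_minus (tree t (Suc n))) \<longleftrightarrow>
     p \<in> Field P \<and> length q < rank_of P p \<and> set q \<subseteq> {..<t}"
  (is "?L \<longleftrightarrow> ?R")
proof
  assume ?L
  then have "((p, q), (p, q)) \<in> rees_product P_minus (tree t (Suc n))"
    using rees_product_partial_order[OF P_minus_partial_order tree_partial_order, of t "Suc n"]
    by (auto simp: partial_order_on_def preorder_on_def refl_on_def)
  then show ?R unfolding rees_product_iff by (auto intro: FieldI1)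
next
  assume ?R
  then have "((p, q), (p, q)) \<in> rees_product P_minus (tree t (Suc n))"
    by (auto simp: rees_product_iff P_refl)
  then show ?L by (rule FieldI1)
qed

lemma Old_in_Field_R:
  "Old (p, q) \<in> Field R \<longleftrightarrow> p \<in> Field P \<and> length q < rank_of P p \<and> set q \<subseteq> {..<t}"
  by (auto simp: Rees_def Field_adjoin_bounds Field_rees_product)

lemma R_partial_order: "finite (Field R)" "Partial_order R"
  unfolding Rees_def
  by (intro adjoin_bounds_partial_order
      rees_product_partial_order[OF P_minus_partial_order tree_partial_order])+

lemma strictly_below_New_Zero:
  "strictly_below R New_Zero y \<longleftrightarrow> y \<in> Field R \<and> y \<noteq> New_Zero"
  by (auto simp: strictly_below_def Rees_def)

text \<open>
  With equal first components the words have equal length and hence coincide, so strictness in \<open>R\<close> is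
  strictness in \<open>P\<close>.
\<close>

lemma strictly_below_Old_iff:
  assumes "Old (p, q) \<in> Field R"
  shows "strictly_below R (Old (p, q)) (Old (p', q')) \<longleftrightarrow>
    strictly_below P p p' \<and> q' \<in> extensions t q (rank_of P p' - rank_of P p)"
proof (cases "(p, p') \<in> P")
  case True
  then have "rank_of P p \<le> rank_of P p'" by (rule rank_P_mono)
  moreover have "q = q'" if "prefix q q'" "length q' \<le> length q"
    using that by (auto simp: prefix_def)
  ultimately show ?thesis
    using assms unfolding Old_in_Field_R
    by (auto simp: strictly_below_def Rees_def rees_product_iff extensions_def True)
next
  case False
  then show ?thesis by (auto simp: strictly_below_def Rees_def rees_product_iff)
qed

lemma rank_Rees:
  assumes "Old (p, q) \<in> Field R"
  shows "rank_of R (Old (p, q)) = rank_of P p"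
proof -
  have p: "p \<in> Field P" "length q < rank_of P p" "set q \<subseteq> {..<t}"
    using assms by (simp_all add: Old_in_Field_R)
  then have "p \<noteq> zero_hat P" using rank_of_zero_hat[OF graded] by auto
  then obtain C where C: "C \<in> Chains P" "p \<in> C" "\<And>y. y \<in> C \<Longrightarrow> (y, p) \<in> P" "zero_hat P \<notin> C"
    "card C = rank_of P p"
    using longest_chain_minus_zero[OF p(1)] by metis
  \<comment> \<open>The default for \<open>New_One\<close> only has to exceed every rank in \<open>P\<close>.\<close>
  define f :: "('a \<times> nat list) adjoined \<Rightarrow> nat"
    where "f x = (case x of New_Zero \<Rightarrow> 0 | Old a \<Rightarrow> rank_of P (fst a) | New_One \<Rightarrow> n + 2)" for x
  \<comment> \<open>Truncating \<open>q\<close> according to the rank makes the words grow no faster than the ranks.\<close>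
  define lift where "lift c = Old (c, take (rank_of P c - 1) q)" for c
  have lift_le: "(lift c, lift c') \<in> R" if "(c, c') \<in> P" "c \<in> C" for c c'
  proof -
    have "c \<in> Field P" "c \<noteq> zero_hat P" using that C(4) by (auto simp: Field_def)
    then have "rank_of P c > 0" using rank_P_zero_iff by auto
    moreover have "rank_of P c \<le> rank_of P c'" using that(1) by (rule rank_P_mono)
    moreover have "prefix (take (rank_of P c - 1) q) (take (rank_of P c' - 1) q)"
      using \<open>rank_of P c \<le> rank_of P c'\<close>
      by (metis diff_le_mono min.absorb1 take_is_prefix take_take)
    ultimately show ?thesis
      using that(1) p(3)
      by (auto simp: lift_def Rees_def rees_product_iff dest: in_set_takeD)
  qed
  have lift_p: "lift p = Old (p, q)" using p(2) by (simp add: lift_def)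
  have fin: "finite C" using C(5) p(2) card.infinite by fastforce
  have CF: "c \<in> Field P" if "c \<in> C" for c using C(3)[OF that] by (auto simp: Field_def)
  have lift_F: "lift c \<in> Field R" if "c \<in> C" for c
    using lift_le[OF P_refl[OF CF[OF that]] that] by (rule FieldI1)
  have "rank_of R (Old (p, q)) = f (Old (p, q))"
  proof (rule rank_of_eqI[where C = "insert New_Zero (lift ` C)"])
    show "finite (Field R)" "Refl R"
      using R_partial_order by (auto simp: partial_order_on_def preorder_on_def)
    show "f u < f v" if uv: "strictly_below R u v" for u v
    proof -
      have F: "u \<in> Field R" "v \<in> Field R" using uv by (auto simp: strictly_below_def Field_def)
      show ?thesis
      proof (cases u)
        case New_Zero
        then show ?thesis using uv F
          by (cases v) (auto simp: f_def strictly_below_def Old_in_Field_R)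
      next
        case (Old a)
        obtain p1 q1 where u: "u = Old (p1, q1)" using Old by (cases a) auto
        show ?thesis
        proof (cases v)
          case New_Zero
          then show ?thesis using uv u by (auto simp: strictly_below_def Rees_def)
        next
          case (Old b)
          then obtain p2 q2 where v: "v = Old (p2, q2)" by (cases b) auto
          have "strictly_below P p1 p2"
            using uv F(1) strictly_below_Old_iff unfolding u v by blast
          then show ?thesis by (simp add: u v f_def rank_P_less)
        next
          case New_One
          then show ?thesis
            using F(1) rank_P_le[of p1] by (auto simp: u f_def Old_in_Field_R)
        qed
      next
        case New_One
        then show ?thesis using uv by (auto simp: strictly_below_def Rees_def)
      qed
    qed
    show "insert New_Zero (lift ` C) \<in> Chains R"
    proof -
      have "(New_Zero, x) \<in> R" if "x \<in> insert New_Zero (lift ` C)" for x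
        using that lift_F by (auto simp: Rees_def Field_adjoin_bounds)
      then show ?thesis
        using C(1) lift_le by (fastforce simp: Chains_def)
    qed
    show "Old (p, q) \<in> insert New_Zero (lift ` C)" using C(2) lift_p by force
    show "(y, Old (p, q)) \<in> R" if "y \<in> insert New_Zero (lift ` C)" for y
      using that lift_le[OF C(3)] assms by (auto simp: lift_p[symmetric] Rees_def)
    have "inj_on lift C" "New_Zero \<notin> lift ` C" by (auto simp: inj_on_def lift_def)
    then show "card (insert New_Zero (lift ` C)) = f (Old (p, q)) + 1"
      using fin C(5) by (simp add: card_image f_def)
  qed
  then show ?thesis by (simp add: f_def)
qed

lemma one_hat_P_in_Field: "one_hat P \<in> Field P"
  using graded theI'[of "maximal_in P"] by (simp add: graded_def one_hat_def maximal_in_def)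

lemma rank_R_New_One: "rank_of R New_One > n + 1"
proof -
  have "Old (one_hat P, []) \<in> Field R"
    using one_hat_P_in_Field rank_P by (simp add: Old_in_Field_R poset_rank_def)
  moreover from this have "strictly_below R (Old (one_hat P, [])) New_One"
    by (auto simp: strictly_below_def Rees_def)
  ultimately show ?thesis
    using rank_of_less[OF R_partial_order] rank_Rees[of "one_hat P" "[]"] rank_P
    by (fastforce simp: poset_rank_def)
qed

section \<open>Decorating chains with words\<close>

text \<open>
  The set of admissible words is the same for all \<open>p'\<close> of rank \<open>s\<close>, so one step of the recursion for chains in
  \<open>R\<close> is the corresponding step in \<open>P\<close> times a bracket.
\<close>

lemma card_chains_from_R_Cons:
  assumes above: "{y. strictly_below R x y \<and> rank_of R y = s}
      = Old ` ({p'. strictly_below P p p' \<and> rank_of P p' = s} \<times> extensions t q d)"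
    and q: "set q \<subseteq> {..<t}"
    and IH: "\<And>p' q'. Old (p', q') \<in> Field R \<Longrightarrow>
      card (chains_from R (Old (p', q')) ss) = list_weight t (rank_of P p') ss * card (chains_from P p' ss)"
  shows "card (chains_from R x (s # ss))
    = bracket t (d + 1) * list_weight t s ss * card (chains_from P p (s # ss))"
proof -
  let ?B = "{p'. strictly_below P p p' \<and> rank_of P p' = s}" and ?E = "extensions t q d"
  have F: "Old (p', q') \<in> Field R" if "p' \<in> ?B" "q' \<in> ?E" for p' q'
  proof -
    have "strictly_below R x (Old (p', q'))" using above that by blast
    then show ?thesis by (auto simp: strictly_below_def Field_def)
  qed
  have "card (chains_from R x (s # ss)) = (\<Sum>y\<in>Old ` (?B \<times> ?E). card (chains_from R y ss))"
    unfolding card_chains_from_Cons[OF R_partial_order] above ..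
  also have "\<dots> = (\<Sum>(p', q')\<in>?B \<times> ?E. card (chains_from R (Old (p', q')) ss))"
    by (subst sum.reindex) (auto simp: inj_on_def intro!: sum.cong)
  also have "\<dots> = (\<Sum>(p', q')\<in>?B \<times> ?E. list_weight t s ss * card (chains_from P p' ss))"
    by (rule sum.cong) (use F IH in auto)
  also have "\<dots> = (\<Sum>p'\<in>?B. \<Sum>q'\<in>?E. list_weight t s ss * card (chains_from P p' ss))"
    by (simp only: sum.cartesian_product)
  also have "\<dots> = bracket t (d + 1) * list_weight t s ss * (\<Sum>p'\<in>?B. card (chains_from P p' ss))"
    by (simp only: sum_constant card_extensions[OF q] sum_distrib_left mult.assoc of_nat_id)
  also have "(\<Sum>p'\<in>?B. card (chains_from P p' ss)) = card (chains_from P p (s # ss))"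
    unfolding card_chains_from_Cons[OF P_partial_order] ..
  finally show ?thesis .
qed

lemma card_chains_from_Old:
  assumes "Old (p, q) \<in> Field R" "\<And>s. s \<in> set ss \<Longrightarrow> s \<le> n + 1"
  shows "card (chains_from R (Old (p, q)) ss)
    = list_weight t (rank_of P p) ss * card (chains_from P p ss)"
  using assms
proof (induction ss arbitrary: p q)
  case Nil
  then show ?case by (simp add: chains_from_Nil)
next
  case (Cons s ss)
  note F = Cons.prems(1)
  have "{y. strictly_below R (Old (p, q)) y \<and> rank_of R y = s}
      = Old ` ({p'. strictly_below P p p' \<and> rank_of P p' = s} \<times> extensions t q (s - rank_of P p))"
    (is "?L = ?R")
  proof (intro equalityI subsetI)
    fix y assume y: "y \<in> ?L"
    then have yF: "y \<in> Field R" by (auto simp: strictly_below_def Field_def)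
    have "y \<noteq> New_One" using y rank_R_New_One Cons.prems(2)[of s] by auto
    moreover have "y \<noteq> New_Zero" using y by (auto simp: strictly_below_def Rees_def)
    ultimately obtain p' q' where y': "y = Old (p', q')" by (cases y) auto
    then show "y \<in> ?R"
      using y strictly_below_Old_iff[OF F, of p' q'] rank_Rees[of p' q'] yF by auto
  next
    fix y assume "y \<in> ?R"
    then obtain p' q' where y: "y = Old (p', q')" "strictly_below P p p'" "rank_of P p' = s"
        "q' \<in> extensions t q (s - rank_of P p)"
      by auto
    then have "strictly_below R (Old (p, q)) y"
      using strictly_below_Old_iff[OF F] by simp
    moreover from this have "y \<in> Field R" by (auto simp: strictly_below_def Field_def)
    ultimately show "y \<in> ?L" using y rank_Rees by simp
  qed
  moreover have "set q \<subseteq> {..<t}" using F by (simp add: Old_in_Field_R)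
  ultimately show ?case
    using Cons by (subst card_chains_from_R_Cons) auto
qed

text \<open>
  The adjoined minimum behaves like the pair of the least element of \<open>P\<close> and the empty word, except
  that it counts as rank 1: the first word has length at most \<open>s - 1\<close>.
\<close>

lemma card_chains_from_New_Zero:
  assumes "\<And>s. s \<in> set ss \<Longrightarrow> s \<le> n + 1"
  shows "card (chains_from R New_Zero ss)
    = list_weight t 1 ss * card (chains_from P (zero_hat P) ss)"
proof (cases ss)
  case Nil
  then show ?thesis by (simp add: chains_from_Nil)
next
  case (Cons s ss')
  have above_zero: "strictly_below P (zero_hat P) p' \<longleftrightarrow> p' \<in> Field P \<and> rank_of P p' > 0" for p'
    using zero_hat_least[OF graded, of p'] rank_P_zero_iff[of p'] FieldI2[of _ p' P]
    by (auto simp: strictly_below_def)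
  have "{y. strictly_below R New_Zero y \<and> rank_of R y = s}
      = Old ` ({p'. strictly_below P (zero_hat P) p' \<and> rank_of P p' = s} \<times> extensions t [] (s - 1))"
    (is "?L = ?R")
  proof (intro equalityI subsetI)
    fix y assume y: "y \<in> ?L"
    then have yF: "y \<in> Field R" "y \<noteq> New_Zero" by (auto simp: strictly_below_New_Zero)
    have "y \<noteq> New_One" using y rank_R_New_One assms[of s] Cons by auto
    then obtain p' q' where y': "y = Old (p', q')" using yF by (cases y) auto
    then show "y \<in> ?R"
      using y yF rank_Rees[of p' q'] by (auto simp: above_zero extensions_def Old_in_Field_R)
  next
    fix y assume "y \<in> ?R"
    then obtain p' q' where y: "y = Old (p', q')" "p' \<in> Field P" "rank_of P p' = s" "s > 0"
        "q' \<in> extensions t [] (s - 1)"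
      by (auto simp: above_zero)
    then have "y \<in> Field R" by (auto simp: Old_in_Field_R extensions_def)
    then show "y \<in> ?L" using y rank_Rees by (simp add: strictly_below_New_Zero)
  qed
  then show ?thesis
    unfolding Cons using assms Cons
    by (subst card_chains_from_R_Cons) (auto intro: card_chains_from_Old)
qed

lemma flag_f_R:
  assumes "S \<subseteq> {1..n + 1}"
  shows "flag_f R S = weight t S * card (chains_from P (zero_hat P) (sorted_list_of_set S))"
proof -
  have fin: "finite S" using assms finite_subset by blast
  have hats: "zero_hat R = New_Zero" "one_hat R = New_One"
    by (simp_all add: Rees_def zero_hat_adjoin_bounds one_hat_adjoin_bounds)
  have "flag_f R S = card (chains_from R (zero_hat R) (sorted_list_of_set S))"
  proof (rule flag_f_eq_card_chains_from[OF R_partial_order])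
    show "(x, one_hat R) \<in> R" if "x \<in> Field R" for x
      unfolding hats using that by (simp add: Rees_def)
    show "zero_hat R \<in> Field R" unfolding hats by (simp add: Rees_def Field_adjoin_bounds)
    show "zero_hat R \<noteq> one_hat R" unfolding hats by simp
    show "s < poset_rank R" if "s \<in> S" for s
      using that assms rank_R_New_One by (auto simp: poset_rank_def hats intro: le_less_trans)
  qed (rule fin)
  also have "\<dots> = list_weight t 1 (sorted_list_of_set S)
      * card (chains_from P (zero_hat P) (sorted_list_of_set S))"
    unfolding hats using assms fin by (intro card_chains_from_New_Zero) auto
  also have "list_weight t 1 (sorted_list_of_set S) = weight t S"
    using weight_eq_list_weight[OF fin] assms by force
  finally show ?thesis .
qed

end

section \<open>The flag vector of the Rees product\<close>

theorem lemma2p2: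
  fixes P :: "'a rel" and n t :: nat and S :: "nat set"
  assumes "graded P" and "poset_rank P = n + 1"
    and "S \<subseteq> {1..n}"
  shows "flag_f (Rees P (tree t (n + 1))) S = weight t S * flag_f P S
    \<and> flag_f (Rees P (tree t (n + 1))) (S \<union> {n + 1}) = weight t (S \<union> {n + 1}) * flag_f P S"
proof -
  interpret rees_tree P n t using assms(1,2) by unfold_locales
  let ?ss = "sorted_list_of_set S" and ?z = "zero_hat P"
  have fin: "finite S" using assms(3) finite_subset by blast
  have S_less: "s < n + 1" if "s \<in> S" for s using that assms(3) by auto
  have flag_P: "flag_f P S = card (chains_from P ?z ?ss)"
    using fin S_less by (intro flag_f_graded[OF assms(1)]) (auto simp: assms(2))
  have "sorted (?ss @ [n + 1])" "distinct (?ss @ [n + 1])" "set (?ss @ [n + 1]) = S \<union> {n + 1}"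
    using fin S_less by (auto simp: sorted_append less_imp_le)
  then have "sorted_list_of_set (S \<union> {n + 1}) = ?ss @ [n + 1]"
    by (metis sorted_list_of_set.idem_if_sorted_distinct)
  moreover have "card (chains_from P ?z (?ss @ [poset_rank P])) = card (chains_from P ?z ?ss)"
  proof (rule card_chains_from_snoc_poset_rank[OF assms(1)])
    show "?z \<in> Field P"
      using zero_hat_least[OF assms(1) one_hat_P_in_Field] by (rule FieldI1)
    show "rank_of P ?z < poset_rank P" by (simp add: rank_of_zero_hat[OF assms(1)] assms(2))
    show "s < poset_rank P" if "s \<in> set ?ss" for s using that fin S_less assms(2) by simp
  qed
  ultimately have "card (chains_from P ?z (sorted_list_of_set (S \<union> {n + 1}))) = flag_f P S"
    by (simp add: assms(2) flag_P)
  moreover have "S \<subseteq> {1..n + 1}" "S \<union> {n + 1} \<subseteq> {1..n + 1}" using assms(3) by auto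
  ultimately show ?thesis using flag_f_R[of S] flag_f_R[of "S \<union> {n + 1}"] flag_P
    unfolding Suc_eq_plus1 by simp
qed

end
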